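(* Let $p,q$ be two distinct constants with $q<p$, and let $G\sim G(kn,k,p,q)$ be an unweighted random graph from the planted partition model with partition function $\Psi$. Let $H=H(V,E,w)$ be the auxiliary weighted graph derived from $G$ (same vertices and edges), in which each edge $(u,v)$ has weight $w(u,v)=t(u,v)$, the number of triangles of $G$ that contain the edge $(u,v)$. Consider random walks $X_t$ and $Y_t$ on the vertices of $G$ and $H$, respectively, where the walk on $G$ is the standard random walk (from $u$, move to a uniformly random neighbor of $u$), and the walk on $H$ moves from $u$ to a neighbor $v$ chosen with probability proportional to the edge weight $w(u,v)$. Then with probability $1-o(1)$ over the choice of $G$, for all vertices $u$, $$\Pr\big(\Psi(X_{t+1})=\Psi(X_t)\mid X_t=u\big)<\Pr\big(\Psi(Y_{t+1})=\Psi(Y_t)\mid Y_t=u\big).$$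
   Context: Planted partition model $G(kn,k,p,q)$: the vertex set $V$ has $kn$ vertices and is partitioned into $k$ clusters, each with exactly $n$ vertices. The partition function $\Psi:V\to[k]$ maps each vertex to its cluster. Each pair of distinct vertices $u,v$ is joined by an edge, independently, with probability $p$ if $\Psi(u)=\Psi(v)$ and with probability $q<p$ otherwise. The $o(1)$ is as $n\to\infty$. The probabilities in the displayed inequality are over one step of the walk, for the given graph $G$. If a vertex $u$ is in no triangle, the triangle-weighted walk (the walk on $H$) stays at $u$.
   Formalization: The formal statement assumes q > 0 and at least two clusters (k ≥ 2, with k fixed as n → ∞); if q = 0 or k = 1 all edges lie inside clusters, both probabilities equal 1, and the strict inequality fails. *)

theory Defs
  imports "HOL-Probability.Probability"
begin

text \<open>A graph on a vertex set \<open>V\<close> is given by its edge set, a set of two-element subsets of \<open>V\<close>.\<close>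

definition vertex_pairs :: "'a set \<Rightarrow> 'a set set" where
  "vertex_pairs V = {e. e \<subseteq> V \<and> card e = 2}"

definition neighbors :: "'a set set \<Rightarrow> 'a \<Rightarrow> 'a set" where
  "neighbors E u = {v. {u, v} \<in> E}"

definition balanced_clusters :: "'a set \<Rightarrow> ('a \<Rightarrow> nat) \<Rightarrow> nat \<Rightarrow> nat \<Rightarrow> bool" where
  "balanced_clusters V \<Psi> k n \<longleftrightarrow>
     finite V \<and> card V = k * n \<and> \<Psi> ` V \<subseteq> {1..k} \<and>
     (\<forall>c\<in>{1..k}. card {v \<in> V. \<Psi> v = c} = n)"

definition planted_partition :: "'a set \<Rightarrow> ('a \<Rightarrow> nat) \<Rightarrow> real \<Rightarrow> real \<Rightarrow> 'a set set pmf" where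
  "planted_partition V \<Psi> p q =
     map_pmf (\<lambda>f. {e \<in> vertex_pairs V. f e})
       (Pi_pmf (vertex_pairs V) False
         (\<lambda>e. bernoulli_pmf (if \<forall>u\<in>e. \<forall>v\<in>e. \<Psi> u = \<Psi> v then p else q)))"

definition triangles :: "'a set set \<Rightarrow> 'a set set" where
  "triangles E = {T. card T = 3 \<and> (\<forall>u\<in>T. \<forall>v\<in>T. u \<noteq> v \<longrightarrow> {u, v} \<in> E)}"

definition triangle_count :: "'a set set \<Rightarrow> 'a set \<Rightarrow> nat" where
  "triangle_count E e = card {T \<in> triangles E. e \<subseteq> T}"

text \<open>One-step distributions of the walks. A walk that has nowhere to go (no neighbor, or total
  weight zero) stays where it is.\<close>

definition walk_step :: "'a set set \<Rightarrow> 'a \<Rightarrow> 'a pmf" where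
  "walk_step E u =
     (if neighbors E u = {} then return_pmf u else pmf_of_set (neighbors E u))"

definition weighted_walk_step :: "'a set set \<Rightarrow> ('a set \<Rightarrow> real) \<Rightarrow> 'a \<Rightarrow> 'a pmf" where
  "weighted_walk_step E w u =
     (if (\<Sum>v\<in>neighbors E u. w {u, v}) = 0 then return_pmf u
      else embed_pmf (\<lambda>v. if v \<in> neighbors E u
                          then w {u, v} / (\<Sum>v'\<in>neighbors E u. w {u, v'}) else 0))"

text \<open>\<open>embed_pmf\<close> is only meaningful for functions that sum to one; this is the case here.\<close>

lemma pmf_weighted_walk_step:
  assumes fin: "finite (neighbors E u)"
    and nonneg: "\<And>v. v \<in> neighbors E u \<Longrightarrow> 0 \<le> w {u, v}"
    and pos: "(\<Sum>v\<in>neighbors E u. w {u, v}) \<noteq> 0"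
  shows "pmf (weighted_walk_step E w u) v =
    (if v \<in> neighbors E u then w {u, v} / (\<Sum>v'\<in>neighbors E u. w {u, v'}) else 0)"
proof -
  define N where "N = neighbors E u"
  define S where "S = (\<Sum>v\<in>N. w {u, v})"
  define f where "f = (\<lambda>v. if v \<in> N then w {u, v} / S else 0)"
  have S: "S > 0"
    using pos nonneg by (simp add: S_def N_def sum_nonneg less_le)
  have f_nonneg: "0 \<le> f x" for x
    using S nonneg by (auto simp: f_def N_def)
  have "(\<integral>\<^sup>+x. ennreal (f x) \<partial>count_space UNIV) = (\<Sum>x\<in>N. ennreal (f x))"
    by (rule nn_integral_count_space') (use fin in \<open>auto simp: f_def N_def\<close>)
  also have "\<dots> = ennreal (\<Sum>x\<in>N. f x)"
    using f_nonneg by (simp add: sum_ennreal)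
  also have "(\<Sum>x\<in>N. f x) = (\<Sum>x\<in>N. w {u, x}) / S"
    by (simp add: f_def sum_divide_distrib)
  also have "\<dots> = 1"
    using S by (simp flip: S_def)
  finally have "(\<integral>\<^sup>+x. ennreal (f x) \<partial>count_space UNIV) = 1"
    by simp
  then have "pmf (embed_pmf f) v = f v"
    by (intro pmf_embed_pmf f_nonneg)
  moreover have "weighted_walk_step E w u = embed_pmf f"
    using pos unfolding weighted_walk_step_def f_def S_def N_def by (rule if_not_P)
  ultimately show ?thesis
    by (simp add: f_def S_def N_def)
qed

definition triangle_walk_step :: "'a set set \<Rightarrow> 'a \<Rightarrow> 'a pmf" where
  "triangle_walk_step E = weighted_walk_step E (\<lambda>e. real (triangle_count E e))"

definition same_cluster_prob :: "('a \<Rightarrow> nat) \<Rightarrow> ('a \<Rightarrow> 'a pmf) \<Rightarrow> 'a \<Rightarrow> real" where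
  "same_cluster_prob \<Psi> step u = measure_pmf.prob (step u) {v. \<Psi> v = \<Psi> u}"

end

theory Submission
  imports Defs "HOL-Real_Asymp.Real_Asymp"
begin

text \<open>The weight of an edge \<open>{u, v}\<close> is the number of common neighbors of \<open>u\<close> and \<open>v\<close>. Its expectation
  is larger by about \<open>n (p - q)\<^sup>2\<close> when the two clusters agree. By Hoeffding's inequality and a union
  bound over all pairs, with high probability every weight inside a cluster exceeds some threshold
  \<open>\<tau>\<close> and every weight between clusters stays below it. If in addition \<open>u\<close> has neighbors of both
  kinds, weighting by \<open>t\<close> strictly increases the share of the neighbors in its own cluster.\<close>

section \<open>One step of the two walks\<close>

lemma neighbors_subset:
  assumes "E \<subseteq> vertex_pairs V"
  shows "neighbors E u \<subseteq> V - {u}"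
  using assms by (auto simp: neighbors_def vertex_pairs_def)

text \<open>A triangle through the edge is determined by its third vertex, so \<open>w\<close>
  \<mapsto> \<open>{u, v, w}\<close> is a bijection. This turns edge weights into sums of
  indicators, one for each candidate \<open>w\<close>.\<close>

lemma triangle_count_eq_common_neighbors:
  assumes E: "E \<subseteq> vertex_pairs V" and e: "{u, v} \<in> E"
  shows "triangle_count E {u, v} = card {w \<in> V - {u, v}. {u, w} \<in> E \<and> {v, w} \<in> E}"
proof -
  have neq: "u \<noteq> v"
    using E e by (auto simp: vertex_pairs_def)
  have "bij_betw (\<lambda>w. {u, v, w}) {w \<in> V - {u, v}. {u, w} \<in> E \<and> {v, w} \<in> E}
          {T \<in> triangles E. {u, v} \<subseteq> T}"
  proof (rule bij_betw_imageI)
    show "inj_on (\<lambda>w. {u, v, w}) {w \<in> V - {u, v}. {u, w} \<in> E \<and> {v, w} \<in> E}"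
      by (rule inj_onI) auto
    show "(\<lambda>w. {u, v, w}) ` {w \<in> V - {u, v}. {u, w} \<in> E \<and> {v, w} \<in> E} =
            {T \<in> triangles E. {u, v} \<subseteq> T}"
    proof (intro equalityI subsetI)
      fix T assume "T \<in> (\<lambda>w. {u, v, w}) ` {w \<in> V - {u, v}. {u, w} \<in> E \<and> {v, w} \<in> E}"
      then show "T \<in> {T \<in> triangles E. {u, v} \<subseteq> T}"
        using neq e by (auto simp: triangles_def insert_commute)
    next
      fix T assume "T \<in> {T \<in> triangles E. {u, v} \<subseteq> T}"
      then have T: "card T = 3" "\<And>x y. x \<in> T \<Longrightarrow> y \<in> T \<Longrightarrow> x \<noteq> y \<Longrightarrow> {x, y} \<in> E" "{u, v} \<subseteq> T"
        by (auto simp: triangles_def)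
      have "card (T - {u, v}) = 1"
        using T neq by (subst card_Diff_subset) auto
      then obtain w where w: "T - {u, v} = {w}"
        by (auto simp: card_1_singleton_iff)
      then have T_eq: "T = {u, v, w}" and "w \<notin> {u, v}"
        using T(3) by auto
      moreover from this have edges: "{u, w} \<in> E" "{v, w} \<in> E"
        using T(2) by auto
      moreover have "w \<in> V"
        using edges E by (auto simp: vertex_pairs_def)
      ultimately show "T \<in> (\<lambda>w. {u, v, w}) ` {w \<in> V - {u, v}. {u, w} \<in> E \<and> {v, w} \<in> E}"
        by auto
    qed
  qed
  from bij_betw_same_card[OF this] show ?thesis
    by (simp only: triangle_count_def)
qed

section \<open>Same-cluster probabilities of the two walks\<close>

lemma same_cluster_prob_walk_step:
  assumes "finite (neighbors E u)" "neighbors E u \<noteq> {}"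
  shows "same_cluster_prob \<Psi> (walk_step E) u =
    card {v \<in> neighbors E u. \<Psi> v = \<Psi> u} / card (neighbors E u)"
  using assms by (simp add: same_cluster_prob_def walk_step_def measure_pmf_of_set Int_def)

lemma same_cluster_prob_weighted_walk_step:
  assumes fin: "finite (neighbors E u)"
    and nonneg: "\<And>v. v \<in> neighbors E u \<Longrightarrow> 0 \<le> w {u, v}"
    and pos: "(\<Sum>v\<in>neighbors E u. w {u, v}) \<noteq> 0"
  shows "same_cluster_prob \<Psi> (weighted_walk_step E w) u =
    (\<Sum>v | v \<in> neighbors E u \<and> \<Psi> v = \<Psi> u. w {u, v}) / (\<Sum>v\<in>neighbors E u. w {u, v})"
proof -
  have pmf: "pmf (weighted_walk_step E w u) v =
      (if v \<in> neighbors E u then w {u, v} / (\<Sum>v'\<in>neighbors E u. w {u, v'}) else 0)" for v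
    by (rule pmf_weighted_walk_step) (use assms in auto)
  have "same_cluster_prob \<Psi> (weighted_walk_step E w) u =
      measure_pmf.prob (weighted_walk_step E w u) {v \<in> neighbors E u. \<Psi> v = \<Psi> u}"
    \<comment> \<open>Non-neighbors carry no mass, so the event shrinks to a finite set, on which
      the probability is a sum of point masses.\<close>
    unfolding same_cluster_prob_def by (rule measure_prob_cong_0) (auto simp: pmf)
  also have "\<dots> = (\<Sum>v | v \<in> neighbors E u \<and> \<Psi> v = \<Psi> u. pmf (weighted_walk_step E w u) v)"
    using fin by (simp add: measure_measure_pmf_finite)
  also have "\<dots> = (\<Sum>v | v \<in> neighbors E u \<and> \<Psi> v = \<Psi> u.
      w {u, v} / (\<Sum>v'\<in>neighbors E u. w {u, v'}))"
    by (rule sum.cong) (auto simp: pmf)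
  finally show ?thesis
    by (simp add: sum_divide_distrib)
qed

text \<open>The average weight is above \<open>\<tau>\<close> on inner neighbors and below
  \<open>\<tau>\<close> on outer ones, so weighting favors the inner ones. Both kinds must occur:
  with inner neighbors only, both probabilities would be 1.\<close>

lemma same_cluster_prob_less_if_separated:
  fixes w :: "'a set \<Rightarrow> real" and \<tau> :: real
  assumes fin: "finite (neighbors E u)"
    and nonneg: "\<And>v. v \<in> neighbors E u \<Longrightarrow> 0 \<le> w {u, v}"
    and inner: "\<And>v. v \<in> neighbors E u \<Longrightarrow> \<Psi> v = \<Psi> u \<Longrightarrow> \<tau> < w {u, v}"
    and outer: "\<And>v. v \<in> neighbors E u \<Longrightarrow> \<Psi> v \<noteq> \<Psi> u \<Longrightarrow> w {u, v} < \<tau>"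
    and ex_inner: "\<exists>v\<in>neighbors E u. \<Psi> v = \<Psi> u"
    and ex_outer: "\<exists>v\<in>neighbors E u. \<Psi> v \<noteq> \<Psi> u"
  shows "same_cluster_prob \<Psi> (walk_step E) u < same_cluster_prob \<Psi> (weighted_walk_step E w) u"
proof -
  define N where "N = neighbors E u"
  define I where "I = {v \<in> N. \<Psi> v = \<Psi> u}"
  define O' where "O' = {v \<in> N. \<Psi> v \<noteq> \<Psi> u}"
  define A where "A = (\<Sum>v\<in>I. w {u, v})"
  define B where "B = (\<Sum>v\<in>O'. w {u, v})"
  have split: "N = I \<union> O'" "I \<inter> O' = {}" and finI: "finite I" and finO: "finite O'"
    using fin by (auto simp: N_def I_def O'_def)
  have ne: "I \<noteq> {}" "O' \<noteq> {}"
    using ex_inner ex_outer by (auto simp: N_def I_def O'_def)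
  have a: "real (card I) > 0" and b: "real (card O') > 0"
    using ne finI finO by (auto simp: card_gt_0_iff)
  have "(\<Sum>v\<in>I. \<tau>) < A"
    unfolding A_def using inner finI ne by (intro sum_strict_mono) (auto simp: I_def N_def)
  then have A: "card I * \<tau> < A" by simp
  have "B < (\<Sum>v\<in>O'. \<tau>)"
    unfolding B_def using outer finO ne by (intro sum_strict_mono) (auto simp: O'_def N_def)
  then have B: "B < card O' * \<tau>" by simp
  have "0 \<le> B"
    unfolding B_def using nonneg by (intro sum_nonneg) (auto simp: O'_def N_def)
  \<comment> \<open>Nonnegative outer weights force a positive threshold. Hence the total weight is
    positive, and the weighted walk is not in its stay-put case.\<close>
  with B b have "0 < \<tau>"
    by (smt (verit) mult_nonneg_nonpos)
  with A a have "0 < A"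
    by (smt (verit) mult_pos_pos)
  have sum_N: "(\<Sum>v\<in>N. w {u, v}) = A + B"
    unfolding A_def B_def split(1) using finI finO split(2) by (rule sum.union_disjoint)
  have card_N: "card N = card I + card O'"
    unfolding split(1) using finI finO split(2) by (rule card_Un_disjoint)
  \<comment> \<open>This chain compares the averages \<open>B / card O'\<close> and
    \<open>A / card I\<close> through \<open>\<tau>\<close> without dividing; the desired inequality
    of fractions is its cross-multiplied form.\<close>
  have "card I * B < card I * (card O' * \<tau>)"
    using B a by simp
  also have "\<dots> = card O' * (card I * \<tau>)"
    by simp
  also have "\<dots> < card O' * A"
    using A b by (simp only: mult_less_cancel_left_pos)
  finally have "card I / (card I + card O') < A / (A + B)"
    using a b \<open>0 < A\<close> \<open>0 \<le> B\<close> by (simp add: divide_simps algebra_simps)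
  moreover have "same_cluster_prob \<Psi> (walk_step E) u = card I / card N"
    unfolding I_def N_def using fin ex_inner by (intro same_cluster_prob_walk_step) auto
  moreover have "same_cluster_prob \<Psi> (weighted_walk_step E w) u = A / (\<Sum>v\<in>N. w {u, v})"
    unfolding A_def I_def N_def mem_Collect_eq
    by (rule same_cluster_prob_weighted_walk_step[where w = w])
       (use fin nonneg sum_N \<open>0 < A\<close> \<open>0 \<le> B\<close> in \<open>auto simp: N_def\<close>)
  ultimately show ?thesis
    by (simp add: sum_N card_N)
qed

text \<open>The separation is demanded for every \<open>v\<close>, adjacent to \<open>u\<close> or
  not. The number of common neighbors does not involve the edge \<open>{u, v}\<close>, so no
  conditioning on that edge is needed later.\<close>

lemma same_cluster_prob_less_triangle_walk:
  fixes \<tau> :: real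
  assumes finV: "finite V" and E: "E \<subseteq> vertex_pairs V"
    and inner: "\<And>v. v \<in> V - {u} \<Longrightarrow> \<Psi> v = \<Psi> u \<Longrightarrow>
      \<tau> < card {w \<in> V - {u, v}. {u, w} \<in> E \<and> {v, w} \<in> E}"
    and outer: "\<And>v. v \<in> V - {u} \<Longrightarrow> \<Psi> v \<noteq> \<Psi> u \<Longrightarrow>
      card {w \<in> V - {u, v}. {u, w} \<in> E \<and> {v, w} \<in> E} < \<tau>"
    and ex: "\<exists>v. {u, v} \<in> E \<and> \<Psi> v = \<Psi> u" "\<exists>v. {u, v} \<in> E \<and> \<Psi> v \<noteq> \<Psi> u"
  shows "same_cluster_prob \<Psi> (walk_step E) u < same_cluster_prob \<Psi> (triangle_walk_step E) u"
  unfolding triangle_walk_step_def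
proof (rule same_cluster_prob_less_if_separated[where \<tau> = \<tau>])
  show "finite (neighbors E u)"
    using neighbors_subset[OF E] finV by (meson finite_Diff finite_subset)
  fix v assume v: "v \<in> neighbors E u"
  then have count: "triangle_count E {u, v} = card {w \<in> V - {u, v}. {u, w} \<in> E \<and> {v, w} \<in> E}"
    by (intro triangle_count_eq_common_neighbors[OF E]) (simp add: neighbors_def)
  have v_in: "v \<in> V - {u}"
    using v neighbors_subset[OF E] by blast
  show "\<tau> < triangle_count E {u, v}" if "\<Psi> v = \<Psi> u"
    unfolding count using v_in that by (rule inner)
  show "triangle_count E {u, v} < \<tau>" if "\<Psi> v \<noteq> \<Psi> u"
    unfolding count using v_in that by (rule outer)
  show "0 \<le> real (triangle_count E {u, v})"
    by simp
next
  show "\<exists>v\<in>neighbors E u. \<Psi> v = \<Psi> u"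
    using ex(1) by (simp add: neighbors_def)
  show "\<exists>v\<in>neighbors E u. \<Psi> v \<noteq> \<Psi> u"
    using ex(2) by (simp add: neighbors_def)
qed

section \<open>Random graphs with independent edges\<close>

text \<open>Outcomes stay Boolean functions, so that edges are independent coordinates. The
  probabilities \<open>P\<close> are arbitrary, which keeps the clusters out of this
  section.\<close>

definition edge_choices :: "'a set \<Rightarrow> ('a set \<Rightarrow> real) \<Rightarrow> ('a set \<Rightarrow> bool) pmf" where
  "edge_choices V P = Pi_pmf (vertex_pairs V) False (\<lambda>e. bernoulli_pmf (P e))"

lemma finite_vertex_pairs: "finite V \<Longrightarrow> finite (vertex_pairs V)"
  by (rule finite_subset[of _ "Pow V"]) (auto simp: vertex_pairs_def)

lemma pair_in_vertex_pairs_iff: "{u, v} \<in> vertex_pairs V \<longleftrightarrow> u \<in> V \<and> v \<in> V \<and> u \<noteq> v"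
  by (auto simp: vertex_pairs_def card_insert_if)

lemma prob_edge_choices_PiE:
  assumes "finite V"
  shows "measure_pmf.prob (edge_choices V P) {f. \<forall>e\<in>vertex_pairs V. f e \<in> B e} =
    (\<Prod>e\<in>vertex_pairs V. measure_pmf.prob (bernoulli_pmf (P e)) (B e))"
proof -
  have "{f. \<forall>e\<in>vertex_pairs V. f e \<in> B e} = Pi (vertex_pairs V) B"
    unfolding Pi_def by blast
  then show ?thesis
    unfolding edge_choices_def
    by (simp only: measure_Pi_pmf_Pi[OF finite_vertex_pairs[OF assms]])
qed

text \<open>The event is a box whose sides outside \<open>A\<close> are \<open>UNIV\<close>; these
  contribute factors 1.\<close>

lemma prob_edge_choices_all:
  assumes "finite V" "A \<subseteq> vertex_pairs V"
  shows "measure_pmf.prob (edge_choices V P) {f. \<forall>e\<in>A. f e = b} =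
    (\<Prod>e\<in>A. pmf (bernoulli_pmf (P e)) b)"
proof -
  have "{f. \<forall>e\<in>A. f e = b} =
      {f. \<forall>e\<in>vertex_pairs V. f e \<in> (if e \<in> A then {b} else UNIV)}"
    using assms(2) by (auto split: if_splits)
  then have "measure_pmf.prob (edge_choices V P) {f. \<forall>e\<in>A. f e = b} =
      (\<Prod>e\<in>vertex_pairs V. measure_pmf.prob (bernoulli_pmf (P e)) (if e \<in> A then {b} else UNIV))"
    using prob_edge_choices_PiE[OF assms(1)] by simp
  also have "\<dots> = (\<Prod>e\<in>A. pmf (bernoulli_pmf (P e)) b)"
    by (rule prod.mono_neutral_cong_right)
       (use assms in \<open>auto simp: finite_vertex_pairs measure_pmf_single\<close>)
  finally show ?thesis .
qed

text \<open>Distinct \<open>v\<close> give distinct pairs, so the absences are independent, each of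
  probability at most \<open>1 - q\<close>.\<close>

lemma prob_no_neighbor_le:
  assumes "finite V" "u \<in> V" "S \<subseteq> V - {u}" "0 \<le> q" "\<And>e. q \<le> P e" "\<And>e. P e \<le> 1"
  shows "measure_pmf.prob (edge_choices V P) {f. \<forall>v\<in>S. \<not> f {u, v}} \<le> (1 - q) ^ card S"
proof -
  have inj: "inj_on (\<lambda>v. {u, v}) S"
    by (rule inj_onI) (auto simp: doubleton_eq_iff)
  have P: "P e \<in> {0..1}" "q \<le> P e" for e
    using assms(4) assms(5,6)[of e] by auto
  have "measure_pmf.prob (edge_choices V P) {f. \<forall>v\<in>S. \<not> f {u, v}} =
      (\<Prod>e\<in>(\<lambda>v. {u, v}) ` S. pmf (bernoulli_pmf (P e)) False)"
    using prob_edge_choices_all[of V "(\<lambda>v. {u, v}) ` S" P False] assms(1-3)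
    by (auto simp: pair_in_vertex_pairs_iff image_subset_iff)
  also have "\<dots> = (\<Prod>v\<in>S. 1 - P {u, v})"
    using P by (simp add: prod.reindex[OF inj])
  also have "\<dots> \<le> (\<Prod>v\<in>S. 1 - q)"
    using P by (intro prod_mono) auto
  finally show ?thesis by simp
qed

text \<open>The indicators are independent because, for distinct \<open>w\<close>, they depend on disjoint pairs of
  edges.\<close>

lemma indep_vars_common_neighbor:
  assumes "finite V" "u \<in> V" "v \<in> V" "u \<noteq> v"
  shows "prob_space.indep_vars (measure_pmf (edge_choices V P)) (\<lambda>_. borel)
    (\<lambda>w f. of_bool (f {u, w} \<and> f {v, w}) :: real) (V - {u, v})"
proof -
  define K where "K w = {{u, w}, {v, w}}" for w
  define g :: "'a \<Rightarrow> ('a set \<Rightarrow> bool) \<Rightarrow> real" where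
    "g w h = of_bool (h {u, w} \<and> h {v, w})" for w h
  have "prob_space.indep_vars (measure_pmf (edge_choices V P)) (\<lambda>_. count_space UNIV)
      (\<lambda>e f. f e) (vertex_pairs V)"
    unfolding edge_choices_def by (rule indep_vars_Pi_pmf) (rule finite_vertex_pairs[OF assms(1)])
  moreover have "K w \<subseteq> vertex_pairs V" if "w \<in> V - {u, v}" for w
    using that assms by (auto simp: K_def pair_in_vertex_pairs_iff)
  \<comment> \<open>An equality \<open>{u, w} = {v, w'}\<close> would force \<open>u = v\<close> or
    \<open>w = v\<close>, and both are excluded.\<close>
  moreover have "disjoint_family_on K (V - {u, v})"
    using assms by (auto simp: disjoint_family_on_def K_def doubleton_eq_iff)
  ultimately have "prob_space.indep_vars (measure_pmf (edge_choices V P))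
      (\<lambda>w. PiM (K w) (\<lambda>_. count_space UNIV)) (\<lambda>w f. restrict (\<lambda>e. f e) (K w)) (V - {u, v})"
    by (rule prob_space.indep_vars_restrict[OF measure_pmf.prob_space_axioms])
  then have "prob_space.indep_vars (measure_pmf (edge_choices V P)) (\<lambda>_. borel)
      (\<lambda>w f. g w (restrict (\<lambda>e. f e) (K w))) (V - {u, v})"
  proof (rule prob_space.indep_vars_compose2[OF measure_pmf.prob_space_axioms])
    fix w
    have [measurable]: "(\<lambda>h. h {u, w}) \<in> PiM (K w) (\<lambda>_. count_space UNIV) \<rightarrow>\<^sub>M count_space UNIV"
      "(\<lambda>h. h {v, w}) \<in> PiM (K w) (\<lambda>_. count_space UNIV) \<rightarrow>\<^sub>M count_space UNIV"
      by (rule measurable_component_singleton; simp add: K_def)+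
    show "g w \<in> borel_measurable (PiM (K w) (\<lambda>_. count_space UNIV))"
      unfolding g_def by measurable
  qed
  then show ?thesis
    by (simp add: g_def K_def)
qed

lemma expectation_common_neighbor:
  assumes "finite V" "u \<in> V" "v \<in> V" "u \<noteq> v" "w \<in> V - {u, v}" "\<And>e. 0 \<le> P e" "\<And>e. P e \<le> 1"
  shows "measure_pmf.expectation (edge_choices V P) (\<lambda>f. of_bool (f {u, w} \<and> f {v, w})) =
    P {u, w} * P {v, w}"
proof -
  have "measure_pmf.expectation (edge_choices V P) (\<lambda>f. of_bool (f {u, w} \<and> f {v, w})) =
      measure_pmf.expectation (edge_choices V P)
        (indicator {f. \<forall>e\<in>{{u, w}, {v, w}}. f e = True})"
    by (rule Bochner_Integration.integral_cong) (auto simp: indicator_def)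
  also have "\<dots> = measure_pmf.prob (edge_choices V P) {f. \<forall>e\<in>{{u, w}, {v, w}}. f e = True}"
    by simp
  also have "\<dots> = (\<Prod>e\<in>{{u, w}, {v, w}}. pmf (bernoulli_pmf (P e)) True)"
    using assms by (intro prob_edge_choices_all) (auto simp: pair_in_vertex_pairs_iff)
  \<comment> \<open>Since \<open>u \<noteq> v\<close>, the two pairs differ and the product really
    has two factors.\<close>
  also have "\<dots> = P {u, w} * P {v, w}"
    using assms by (auto simp: doubleton_eq_iff)
  finally show ?thesis .
qed

text \<open>Hoeffding's inequality for independent indicators indexed by \<open>V - {u, v}\<close>;
  \<open>2 < card V\<close> makes this index set nonempty.\<close>

lemma common_neighbors_tails:
  fixes V :: "'a set" and P :: "'a set \<Rightarrow> real" and \<epsilon> :: real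
  assumes V: "finite V" "u \<in> V" "v \<in> V" "u \<noteq> v" "2 < card V"
    and P: "\<And>e. 0 \<le> P e" "\<And>e. P e \<le> 1" and \<epsilon>: "0 \<le> \<epsilon>"
  defines "\<mu> \<equiv> \<Sum>w\<in>V - {u, v}. P {u, w} * P {v, w}"
    and "X \<equiv> \<lambda>f. real (card {w \<in> V - {u, v}. f {u, w} \<and> f {v, w}})"
  shows "measure_pmf.prob (edge_choices V P) {f. X f \<ge> \<mu> + \<epsilon>} \<le> exp (- 2 * \<epsilon>\<^sup>2 / card V)"
    and "measure_pmf.prob (edge_choices V P) {f. X f \<le> \<mu> - \<epsilon>} \<le> exp (- 2 * \<epsilon>\<^sup>2 / card V)"
proof -
  define Y where "Y w f = (of_bool (f {u, w} \<and> f {v, w}) :: real)" for w and f :: "'a set \<Rightarrow> bool"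
  interpret Hoeffding_ineq "measure_pmf (edge_choices V P)" "V - {u, v}" Y "\<lambda>_. 0" "\<lambda>_. 1" \<mu>
  proof (unfold_locales, goal_cases)
    case 2
    then show ?case
      unfolding Y_def by (rule indep_vars_common_neighbor) (fact V)+
  next
    case 4
    have "\<mu> = (\<Sum>w\<in>V - {u, v}. measure_pmf.expectation (edge_choices V P) (Y w))"
      unfolding \<mu>_def Y_def
      by (intro sum.cong expectation_common_neighbor[symmetric] refl) (use V P in auto)
    then show "\<mu> \<equiv> \<Sum>w\<in>V - {u, v}. measure_pmf.expectation (edge_choices V P) (Y w)"
      by (rule eq_reflection)
  qed (use V in \<open>auto simp: Y_def\<close>)
  have X: "X f = (\<Sum>w\<in>V - {u, v}. Y w f)" for f
    using V(1) by (simp add: X_def Y_def sum.If_cases of_bool_def Int_def)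
  have card: "card (V - {u, v}) = card V - 2"
    using V by (subst card_Diff_subset) auto
  \<comment> \<open>Hoeffding yields the denominator \<open>card V - 2\<close>. Enlarging it to
    \<open>card V\<close> weakens the bound slightly but gives a simpler formula.\<close>
  have le: "exp (- 2 * \<epsilon>\<^sup>2 / (\<Sum>w\<in>V - {u, v}. (1 - 0)\<^sup>2)) \<le> exp (- 2 * \<epsilon>\<^sup>2 / card V)"
    using V by (simp add: card frac_le)
  have pos: "(\<Sum>w\<in>V - {u, v}. (1 - 0 :: real)\<^sup>2) > 0"
    using V by (simp add: card)
  show "measure_pmf.prob (edge_choices V P) {f. X f \<ge> \<mu> + \<epsilon>} \<le> exp (- 2 * \<epsilon>\<^sup>2 / card V)"
    using order_trans[OF Hoeffding_ineq_ge[OF \<epsilon> pos] le] by (simp add: X)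
  show "measure_pmf.prob (edge_choices V P) {f. X f \<le> \<mu> - \<epsilon>} \<le> exp (- 2 * \<epsilon>\<^sup>2 / card V)"
    using order_trans[OF Hoeffding_ineq_le[OF \<epsilon> pos] le] by (simp add: X)
qed

section \<open>The planted partition model\<close>

definition cluster_edge_prob :: "('a \<Rightarrow> nat) \<Rightarrow> real \<Rightarrow> real \<Rightarrow> 'a set \<Rightarrow> real" where
  "cluster_edge_prob \<Psi> p q e = (if \<forall>u\<in>e. \<forall>v\<in>e. \<Psi> u = \<Psi> v then p else q)"

text \<open>Being affine in a cluster indicator, products of these probabilities expand into cluster
  sizes. The formula also covers \<open>u = v\<close>, where the value is \<open>p\<close>.\<close>

lemma cluster_edge_prob_pair:
  "cluster_edge_prob \<Psi> p q {u, v} = q + (p - q) * of_bool (\<Psi> u = \<Psi> v)"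
  by (cases "\<Psi> u = \<Psi> v") (simp_all add: cluster_edge_prob_def)

lemma planted_partition_eq_edge_choices:
  "planted_partition V \<Psi> p q =
    map_pmf (\<lambda>f. {e \<in> vertex_pairs V. f e}) (edge_choices V (cluster_edge_prob \<Psi> p q))"
  by (simp add: planted_partition_def edge_choices_def cluster_edge_prob_def)

section \<open>Expected numbers of common neighbors and their separation\<close>

lemma card_cluster:
  assumes "balanced_clusters V \<Psi> k n" "u \<in> V"
  shows "card {v \<in> V. \<Psi> u = \<Psi> v} = n"
proof -
  have "\<Psi> u \<in> {1..k}"
    using assms by (auto simp: balanced_clusters_def)
  then have "card {v \<in> V. \<Psi> v = \<Psi> u} = n"
    using assms(1) by (auto simp: balanced_clusters_def)
  then show ?thesis by (simp add: eq_commute)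
qed

text \<open>Each linear indicator term sums to \<open>n\<close>; the product of the two indicators
  sums to \<open>n\<close> or 0, which is the whole gap between the two cases. Summing over all of
  \<open>V\<close>, including \<open>u\<close> and \<open>v\<close>, keeps the formula
  exact.\<close>

lemma sum_common_neighbor_prob:
  assumes bal: "balanced_clusters V \<Psi> k n" and "u \<in> V" "v \<in> V"
  shows "(\<Sum>w\<in>V. cluster_edge_prob \<Psi> p q {u, w} * cluster_edge_prob \<Psi> p q {v, w}) =
    k * n * q\<^sup>2 + 2 * n * q * (p - q) + (if \<Psi> u = \<Psi> v then n * (p - q)\<^sup>2 else 0)"
proof -
  have V: "finite V" "card V = k * n"
    using bal by (auto simp: balanced_clusters_def)
  have one: "(\<Sum>w\<in>V. of_bool (\<Psi> x = \<Psi> w)) = real n" if "x \<in> V" for x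
    using V card_cluster[OF bal that] by (simp add: of_bool_def sum.If_cases Int_def)
  have both: "(\<Sum>w\<in>V. of_bool (\<Psi> u = \<Psi> w) * of_bool (\<Psi> v = \<Psi> w)) =
      (if \<Psi> u = \<Psi> v then real n else 0)"
    using one[OF assms(2)] by (auto simp flip: of_bool_conj intro!: sum.neutral)
  have "(\<Sum>w\<in>V. cluster_edge_prob \<Psi> p q {u, w} * cluster_edge_prob \<Psi> p q {v, w}) =
    (\<Sum>w\<in>V. q\<^sup>2 + q * (p - q) * of_bool (\<Psi> u = \<Psi> w) + q * (p - q) * of_bool (\<Psi> v = \<Psi> w) +
      (p - q)\<^sup>2 * (of_bool (\<Psi> u = \<Psi> w) * of_bool (\<Psi> v = \<Psi> w)))"
    by (intro sum.cong refl) (simp add: cluster_edge_prob_pair algebra_simps power2_eq_square)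
  also have "\<dots> = k * n * q\<^sup>2 + q * (p - q) * n + q * (p - q) * n +
      (p - q)\<^sup>2 * (if \<Psi> u = \<Psi> v then real n else 0)"
    unfolding sum.distrib sum_distrib_left[symmetric] one[OF assms(2)] one[OF assms(3)] both
    by (simp add: V)
  finally show ?thesis
    by (simp add: algebra_simps)
qed

text \<open>The midpoint of the expected numbers of common neighbors of two vertices in the same cluster
  and in different clusters, up to an additive constant.\<close>

definition common_threshold :: "nat \<Rightarrow> nat \<Rightarrow> real \<Rightarrow> real \<Rightarrow> real" where
  "common_threshold k n p q = k * n * q\<^sup>2 + 2 * n * q * (p - q) + n * (p - q)\<^sup>2 / 2"

text \<open>The threshold is \<open>n * (p - q)\<^sup>2 / 2\<close> away from either full sum over
  \<open>V\<close>. Half of this distance is the deviation \<open>\<epsilon>\<close>; the other half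
  is at least 2 by the bound on \<open>n\<close> and absorbs the missing summands at
  \<open>u\<close> and \<open>v\<close>.\<close>

lemma prob_common_neighbors_misplaced_le:
  fixes p q :: real
  assumes bal: "balanced_clusters V \<Psi> k n"
    and pq: "0 < q" "q < p" "p \<le> 1" and "2 \<le> k" and n: "8 / (p - q)\<^sup>2 \<le> n"
    and uv: "u \<in> V" "v \<in> V" "u \<noteq> v"
  defines "M \<equiv> edge_choices V (cluster_edge_prob \<Psi> p q)"
    and "X \<equiv> \<lambda>f. real (card {w \<in> V - {u, v}. f {u, w} \<and> f {v, w}})"
    and "\<tau> \<equiv> common_threshold k n p q"
  shows "measure_pmf.prob M {f. if \<Psi> u = \<Psi> v then X f \<le> \<tau> else \<tau> \<le> X f} \<le>
    exp (- ((p - q) ^ 4 / (8 * k) * n))"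
proof -
  define P where "P = cluster_edge_prob \<Psi> p q"
  define \<mu> where "\<mu> = (\<Sum>w\<in>V - {u, v}. P {u, w} * P {v, w})"
  define \<epsilon> where "\<epsilon> = n * (p - q)\<^sup>2 / 4"
  have \<delta>: "0 < (p - q)\<^sup>2" "(p - q)\<^sup>2 \<le> 1"
    using pq by (auto intro: power_le_one)
  have n8: "8 \<le> n * (p - q)\<^sup>2"
    using n \<delta>(1) by (simp add: divide_simps)
  also have "\<dots> \<le> n"
    using \<delta> by (simp add: mult_left_le)
  finally have "8 \<le> n" by simp
  have V: "finite V" "card V = k * n"
    using bal by (auto simp: balanced_clusters_def)
  have "2 * 8 \<le> k * n"
    using \<open>2 \<le> k\<close> \<open>8 \<le> n\<close> by (rule mult_le_mono)
  then have cardV: "2 < card V"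
    by (simp add: V)
  have P: "0 \<le> P e" "P e \<le> 1" for e
    using pq by (auto simp: P_def cluster_edge_prob_def)
  have "0 \<le> \<epsilon>"
    by (simp add: \<epsilon>_def)
  note tails = common_neighbors_tails[where P = P, OF V(1) uv cardV P this, folded \<mu>_def]
  \<comment> \<open>With \<open>card V = k * n\<close>, one factor \<open>n\<close> of
    \<open>\<epsilon>\<^sup>2\<close> cancels, so the exponent is linear in
    \<open>n\<close>.\<close>
  have exp_eq: "exp (- 2 * \<epsilon>\<^sup>2 / card V) = exp (- ((p - q) ^ 4 / (8 * k) * n))"
    using \<open>8 \<le> n\<close> \<open>2 \<le> k\<close>
    by (simp add: \<epsilon>_def V field_simps power2_eq_square power4_eq_xxxx)
  \<comment> \<open>The two extra summands lie in [0, 1], so \<open>\<mu>\<close> falls short of the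
    full sum by at most 2.\<close>
  have "(\<Sum>w\<in>V. P {u, w} * P {v, w}) = \<mu> + (P {u, u} * P {v, u} + P {u, v} * P {v, v})"
    unfolding \<mu>_def using uv V(1)
    by (subst sum.subset_diff[of "{u, v}"]) auto
  moreover have "P {u, u} * P {v, u} \<in> {0..1}" "P {u, v} * P {v, v} \<in> {0..1}"
    using P by (auto intro: mult_le_one)
  ultimately have \<mu>: "\<mu> \<le> (\<Sum>w\<in>V. P {u, w} * P {v, w})" "(\<Sum>w\<in>V. P {u, w} * P {v, w}) - 2 \<le> \<mu>"
    by auto
  show ?thesis
  proof (cases "\<Psi> u = \<Psi> v")
    case True
    have "\<tau> \<le> \<mu> - \<epsilon>"
      using \<mu>(2) n8 True
      by (simp add: P_def sum_common_neighbor_prob[OF bal uv(1,2)] \<tau>_def common_threshold_def \<epsilon>_def)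
    then have "measure_pmf.prob M {f. if \<Psi> u = \<Psi> v then X f \<le> \<tau> else \<tau> \<le> X f} \<le>
        measure_pmf.prob M {f. X f \<le> \<mu> - \<epsilon>}"
      using True by (intro measure_pmf.finite_measure_mono) auto
    also have "\<dots> \<le> exp (- ((p - q) ^ 4 / (8 * k) * n))"
      using tails(2) unfolding exp_eq X_def M_def P_def .
    finally show ?thesis .
  next
    case False
    have "\<mu> + \<epsilon> \<le> \<tau>"
      using \<mu>(1) n8 False
      by (simp add: P_def sum_common_neighbor_prob[OF bal uv(1,2)] \<tau>_def common_threshold_def \<epsilon>_def)
    then have "measure_pmf.prob M {f. if \<Psi> u = \<Psi> v then X f \<le> \<tau> else \<tau> \<le> X f} \<le>
        measure_pmf.prob M {f. \<mu> + \<epsilon> \<le> X f}"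
      using False by (intro measure_pmf.finite_measure_mono) auto
    also have "\<dots> \<le> exp (- ((p - q) ^ 4 / (8 * k) * n))"
      using tails(1) unfolding exp_eq X_def M_def P_def .
    finally show ?thesis .
  qed
qed

text \<open>The Boolean \<open>c\<close> selects the own cluster, with \<open>n - 1\<close>
  candidates besides \<open>u\<close>, or its complement, with \<open>(k - 1) * n\<close>
  candidates. Every candidate edge has probability at least \<open>q\<close>.\<close>

lemma prob_no_neighbor_in_or_outside_cluster_le:
  fixes p q :: real
  assumes bal: "balanced_clusters V \<Psi> k n"
    and pq: "0 < q" "q < p" "p \<le> 1" and "2 \<le> k" and u: "u \<in> V"
  defines "M \<equiv> edge_choices V (cluster_edge_prob \<Psi> p q)"
  shows "measure_pmf.prob M {f. \<forall>v\<in>V - {u}. (\<Psi> v = \<Psi> u) = c \<longrightarrow> \<not> f {u, v}} \<le> (1 - q) ^ (n - 1)"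
proof -
  have V: "finite V" "card V = k * n"
    using bal by (auto simp: balanced_clusters_def)
  define C where "C = {v \<in> V. \<Psi> u = \<Psi> v}"
  define S where "S = {v \<in> V - {u}. (\<Psi> v = \<Psi> u) = c}"
  have C: "finite C" "card C = n" "C \<subseteq> V" "u \<in> C"
    using V(1) card_cluster[OF bal u] u by (auto simp: C_def)
  have "n - 1 \<le> card S"
  proof (cases c)
    case True
    then have "S = C - {u}"
      by (auto simp: S_def C_def)
    then show ?thesis using C by simp
  next
    case False
    then have "S = V - C"
      using u by (auto simp: S_def C_def)
    then have "card S = k * n - n"
      using C V by (simp add: card_Diff_subset)
    moreover have "2 * n \<le> k * n"
      using \<open>2 \<le> k\<close> by simp
    ultimately show ?thesis by linarith
  qed
  have "{f. \<forall>v\<in>V - {u}. (\<Psi> v = \<Psi> u) = c \<longrightarrow> \<not> f {u, v}} = {f. \<forall>v\<in>S. \<not> f {u, v}}"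
    unfolding S_def by blast
  moreover have "measure_pmf.prob M {f. \<forall>v\<in>S. \<not> f {u, v}} \<le> (1 - q) ^ card S"
    unfolding M_def
    by (rule prob_no_neighbor_le) (use pq u V(1) in \<open>auto simp: S_def cluster_edge_prob_def\<close>)
  ultimately have "measure_pmf.prob M {f. \<forall>v\<in>V - {u}. (\<Psi> v = \<Psi> u) = c \<longrightarrow> \<not> f {u, v}} \<le>
      (1 - q) ^ card S"
    by simp
  also have "\<dots> \<le> (1 - q) ^ (n - 1)"
    using pq \<open>n - 1 \<le> card S\<close> by (intro power_decreasing) auto
  finally show ?thesis .
qed

section \<open>Union bound over all failure events, and the limit\<close>

lemma prob_triangle_walk_not_better_le:
  fixes p q :: real
  assumes bal: "balanced_clusters V \<Psi> k n"
    and pq: "0 < q" "q < p" "p \<le> 1" and k: "2 \<le> k" and n: "8 / (p - q)\<^sup>2 \<le> n"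
  shows "measure_pmf.prob (planted_partition V \<Psi> p q)
      {E. \<not> (\<forall>u\<in>V. same_cluster_prob \<Psi> (walk_step E) u < same_cluster_prob \<Psi> (triangle_walk_step E) u)}
    \<le> (k * n)\<^sup>2 * exp (- ((p - q) ^ 4 / (8 * k) * n)) + 2 * (k * n) * (1 - q) ^ (n - 1)"
proof -
  define M where "M = edge_choices V (cluster_edge_prob \<Psi> p q)"
  define X where "X u v f = real (card {w \<in> V - {u, v}. f {u, w} \<and> f {v, w}})"
    for u v :: 'a and f
  define \<tau> where "\<tau> = common_threshold k n p q"
  \<comment> \<open>Two families of failures: \<open>bad\<close> for ordered pairs of distinct
    vertices, at most \<open>(k * n)\<^sup>2\<close> of them, and \<open>iso\<close> for a vertex
    and a choice of side, \<open>2 * (k * n)\<close> in all.\<close>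
  define bad where "bad = (\<lambda>(u, v). {f. if \<Psi> u = \<Psi> v then X u v f \<le> \<tau> else \<tau> \<le> X u v f})"
  define iso where "iso = (\<lambda>(u, c). {f. \<forall>v\<in>V - {u}. (\<Psi> v = \<Psi> u) = c \<longrightarrow> \<not> f {u, v}})"
  define Q where "Q = {(u, v) \<in> V \<times> V. u \<noteq> v}"
  define r where "r = exp (- ((p - q) ^ 4 / (8 * k) * n))"
  have V: "finite V" "card V = k * n"
    using bal by (auto simp: balanced_clusters_def)
  have Q: "finite Q" "Q \<subseteq> V \<times> V"
    using V by (auto simp: Q_def intro: finite_subset[of _ "V \<times> V"])
  have "card Q \<le> (k * n)\<^sup>2"
    using card_mono[OF _ Q(2)] V by (simp add: card_cartesian_product power2_eq_square)
  then have card_Q: "real (card Q) \<le> (k * n)\<^sup>2"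
    by (simp only: of_nat_le_iff)
  \<comment> \<open>Outside all failure events the deterministic comparison applies to every vertex
    with the same \<open>\<tau>\<close>.\<close>
  have "same_cluster_prob \<Psi> (walk_step {e \<in> vertex_pairs V. f e}) u <
      same_cluster_prob \<Psi> (triangle_walk_step {e \<in> vertex_pairs V. f e}) u"
    if "f \<notin> \<Union> (bad ` Q) \<union> \<Union> (iso ` (V \<times> UNIV))" and u: "u \<in> V" for f u
  proof (rule same_cluster_prob_less_triangle_walk[where V = V and \<tau> = \<tau>])
    \<comment> \<open>As \<open>u\<close>, \<open>v\<close> and \<open>w\<close> are distinct
      vertices of \<open>V\<close>, membership in \<open>vertex_pairs V\<close> is
      automatic.\<close>
    have X_eq: "real (card {w \<in> V - {u, v}. {u, w} \<in> {e \<in> vertex_pairs V. f e} \<and>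
        {v, w} \<in> {e \<in> vertex_pairs V. f e}}) = X u v f" if "v \<in> V - {u}" for v
      unfolding X_def using u that
      by (intro arg_cong[of _ _ "\<lambda>A. real (card A)"]) (auto simp: pair_in_vertex_pairs_iff)
    have not_bad: "f \<notin> bad (u, v)" if "v \<in> V - {u}" for v
      using \<open>f \<notin> _\<close> u that by (auto simp: Q_def)
    show "\<tau> < card {w \<in> V - {u, v}. {u, w} \<in> {e \<in> vertex_pairs V. f e} \<and>
        {v, w} \<in> {e \<in> vertex_pairs V. f e}}" if "v \<in> V - {u}" "\<Psi> v = \<Psi> u" for v
      unfolding X_eq[OF that(1)] using not_bad[OF that(1)] that(2) by (simp add: bad_def)
    show "card {w \<in> V - {u, v}. {u, w} \<in> {e \<in> vertex_pairs V. f e} \<and>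
        {v, w} \<in> {e \<in> vertex_pairs V. f e}} < \<tau>" if "v \<in> V - {u}" "\<Psi> v \<noteq> \<Psi> u" for v
      unfolding X_eq[OF that(1)] using not_bad[OF that(1)] that(2) by (simp add: bad_def)
    have ex: "\<exists>v. {u, v} \<in> {e \<in> vertex_pairs V. f e} \<and> (\<Psi> v = \<Psi> u) = c" for c
    proof -
      have "f \<notin> iso (u, c)"
        using \<open>f \<notin> _\<close> u by auto
      then show ?thesis
        using u by (auto simp: iso_def pair_in_vertex_pairs_iff)
    qed
    show "\<exists>v. {u, v} \<in> {e \<in> vertex_pairs V. f e} \<and> \<Psi> v = \<Psi> u"
      using ex[of True] by simp
    show "\<exists>v. {u, v} \<in> {e \<in> vertex_pairs V. f e} \<and> \<Psi> v \<noteq> \<Psi> u"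
      using ex[of False] by simp
  qed (use V in auto)
  then have "measure_pmf.prob (planted_partition V \<Psi> p q)
      {E. \<not> (\<forall>u\<in>V. same_cluster_prob \<Psi> (walk_step E) u < same_cluster_prob \<Psi> (triangle_walk_step E) u)}
    \<le> measure_pmf.prob M (\<Union> (bad ` Q) \<union> \<Union> (iso ` (V \<times> UNIV)))"
    unfolding planted_partition_eq_edge_choices M_def measure_map_pmf
    by (intro measure_pmf.finite_measure_mono) (blast, simp)
  also have "\<dots> \<le> measure_pmf.prob M (\<Union> (bad ` Q)) + measure_pmf.prob M (\<Union> (iso ` (V \<times> UNIV)))"
    by (rule measure_Un_le) auto
  also have "\<dots> \<le> (k * n)\<^sup>2 * r + 2 * (k * n) * (1 - q) ^ (n - 1)"
  proof (rule add_mono)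
    have "measure_pmf.prob M (\<Union> (bad ` Q)) \<le> (\<Sum>x\<in>Q. measure_pmf.prob M (bad x))"
      using Q by (intro measure_UNION_le) auto
    also have "\<dots> \<le> (\<Sum>x\<in>Q. r)"
    proof (rule sum_mono)
      fix x assume "x \<in> Q"
      then obtain u v where "x = (u, v)" "u \<in> V" "v \<in> V" "u \<noteq> v"
        by (auto simp: Q_def)
      then show "measure_pmf.prob M (bad x) \<le> r"
        using prob_common_neighbors_misplaced_le[OF bal pq k n]
        by (simp only: bad_def X_def \<tau>_def M_def r_def prod.case)
    qed
    also have "\<dots> \<le> (k * n)\<^sup>2 * r"
      using mult_right_mono[OF card_Q, of r] by (simp add: r_def)
    finally show "measure_pmf.prob M (\<Union> (bad ` Q)) \<le> (k * n)\<^sup>2 * r" .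
  next
    have "measure_pmf.prob M (\<Union> (iso ` (V \<times> UNIV))) \<le>
        (\<Sum>x\<in>V \<times> UNIV. measure_pmf.prob M (iso x))"
      using V by (intro measure_UNION_le) auto
    also have "\<dots> \<le> (\<Sum>x\<in>V \<times> (UNIV :: bool set). (1 - q) ^ (n - 1))"
    proof (rule sum_mono)
      fix x assume "x \<in> V \<times> (UNIV :: bool set)"
      then obtain u c where "x = (u, c)" "u \<in> V"
        by auto
      then show "measure_pmf.prob M (iso x) \<le> (1 - q) ^ (n - 1)"
        using prob_no_neighbor_in_or_outside_cluster_le[OF bal pq k]
        by (simp only: iso_def M_def prod.case)
    qed
    also have "\<dots> = 2 * (k * n) * (1 - q) ^ (n - 1)"
      by (simp add: card_cartesian_product V)
    finally show "measure_pmf.prob M (\<Union> (iso ` (V \<times> UNIV))) \<le> 2 * (k * n) * (1 - q) ^ (n - 1)" .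
  qed
  finally show ?thesis
    by (simp add: r_def)
qed

theorem lemma1:
  fixes p q :: real and k :: nat
    and V :: "nat \<Rightarrow> 'a set" and \<Psi> :: "nat \<Rightarrow> 'a \<Rightarrow> nat"
  assumes "0 < q" and "q < p" and "p \<le> 1" and "2 \<le> k"
    and "\<And>n. balanced_clusters (V n) (\<Psi> n) k n"
  shows "(\<lambda>n. measure_pmf.prob (planted_partition (V n) (\<Psi> n) p q)
            {E. \<forall>u\<in>V n. same_cluster_prob (\<Psi> n) (walk_step E) u
                        < same_cluster_prob (\<Psi> n) (triangle_walk_step E) u}) \<longlonglongrightarrow> 1"
proof -
  define G where "G n = {E. \<forall>u\<in>V n. same_cluster_prob (\<Psi> n) (walk_step E) u
      < same_cluster_prob (\<Psi> n) (triangle_walk_step E) u}" for n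
  \<comment> \<open>The number of clusters is fixed, so \<open>c\<close> is a positive constant and
    the exponential beats the quadratic number of pairs.\<close>
  define c where "c = (p - q) ^ 4 / (8 * k)"
  define err where "err n = (k * n)\<^sup>2 * exp (- (c * n)) + 2 * (k * n) * (1 - q) ^ (n - 1)" for n :: nat
  have "0 < c"
    using assms by (simp add: c_def)
  have "(\<lambda>n. (real n)\<^sup>2 * exp (- (c * n))) \<longlonglongrightarrow> 0"
    using \<open>0 < c\<close> by real_asymp
  then have "(\<lambda>n. (real k)\<^sup>2 * ((real n)\<^sup>2 * exp (- (c * n)))) \<longlonglongrightarrow> 0"
    by (rule tendsto_mult_right_zero)
  moreover have "(\<lambda>n. 2 * (k * n) * (1 - q) ^ (n - 1)) \<longlonglongrightarrow> 0"
  \<comment> \<open>Shifting the index by one removes the truncated subtraction in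
    \<open>n - 1\<close>.\<close>
  proof (rule LIMSEQ_imp_Suc)
    have "(\<lambda>n. 2 * real k * (n * (1 - q) ^ n) + 2 * real k * (1 - q) ^ n) \<longlonglongrightarrow>
        2 * real k * 0 + 2 * real k * 0"
      using assms by (intro tendsto_intros powser_times_n_limit_0 LIMSEQ_power_zero) auto
    then show "(\<lambda>n. 2 * (k * Suc n) * (1 - q) ^ (Suc n - 1)) \<longlonglongrightarrow> 0"
      by (simp add: algebra_simps)
  qed
  ultimately have "err \<longlonglongrightarrow> 0"
    unfolding err_def[abs_def] by (auto dest: tendsto_add simp: power_mult_distrib mult_ac)
  then have lower: "(\<lambda>n. 1 - err n) \<longlonglongrightarrow> 1"
    by (auto intro!: tendsto_eq_intros)
  \<comment> \<open>The estimate holds only from \<open>8 / (p - q)\<^sup>2\<close> on, which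
    suffices for squeezing the probability between \<open>1 - err n\<close> and 1.\<close>
  have "1 - err n \<le> measure_pmf.prob (planted_partition (V n) (\<Psi> n) p q) (G n)"
    if "8 / (p - q)\<^sup>2 \<le> n" for n
  proof -
    have "measure_pmf.prob (planted_partition (V n) (\<Psi> n) p q) (- G n) \<le> err n"
      using prob_triangle_walk_not_better_le[OF assms(5,1-4) that]
      by (simp add: G_def err_def c_def Compl_eq)
    then show ?thesis
      using measure_pmf.prob_compl[of "G n" "planted_partition (V n) (\<Psi> n) p q"]
      by (simp add: Compl_eq_Diff_UNIV)
  qed
  moreover have "eventually (\<lambda>n. 8 / (p - q)\<^sup>2 \<le> real n) sequentially"
    by real_asymp
  ultimately have "eventually (\<lambda>n. 1 - err n \<le>
      measure_pmf.prob (planted_partition (V n) (\<Psi> n) p q) (G n)) sequentially"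
    by (auto elim: eventually_mono)
  then show ?thesis
    unfolding G_def[symmetric]
    by (intro tendsto_sandwich[OF _ _ lower tendsto_const]) auto
qed

end
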